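(* Let $I\subset\mathbb{R}$ be an interval, let $a,b\in I$ with $a<b$, and let $f:I\to\mathbb{R}$ be twice differentiable on the interior $I^{\circ}$ of $I$, with $f''\in L_1[a,b]$. If $|f''|$ is quasi-convex on $[a,b]$, then $$\left|\frac{1}{b-a}\int_a^b f(x)\,dx-f\left(\frac{a+b}{2}\right)\right|\le \frac{(b-a)^2}{24}\sup\left\{|f''(a)|,|f''(b)|\right\}.$$
   Context: A function $g:[a,b]\to\mathbb{R}$ is quasi-convex on $[a,b]$ if $g(tx+(1-t)y)\le\sup\{g(x),g(y)\}$ for all $x,y\in[a,b]$ and $t\in[0,1]$. The hypotheses on $f''$ over $[a,b]$ presuppose that $f$ is twice differentiable at every point of $[a,b]$; if $a$ or $b$ is an endpoint of $I$, the derivatives $f'$ and $f''$ there are understood as one-sided derivatives. *)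

theory Defs
  imports "HOL-Analysis.Analysis"
begin

definition quasi_convex_on :: "real set \<Rightarrow> (real \<Rightarrow> real) \<Rightarrow> bool" where
  "quasi_convex_on S g \<longleftrightarrow>
    (\<forall>x\<in>S. \<forall>y\<in>S. \<forall>t\<in>{0..1}. g (t * x + (1 - t) * y) \<le> Sup {g x, g y})"

end

theory Submission
  imports Defs
begin

text \<open>
  Quasi-convexity bounds \<open>\<bar>f''\<bar>\<close> on \<open>[a, b]\<close> by the larger endpoint value \<open>M\<close>. Taylor's formula at the
  midpoint \<open>m\<close> then gives \<open>\<bar>f x - f m - f' m (x - m)\<bar> \<le> M (x - m)\<^sup>2 / 2\<close>. Integrating over \<open>[a, b]\<close>
  removes the linear term by symmetry, and the integral of \<open>(x - m)\<^sup>2 / 2\<close> is \<open>(b - a)\<^sup>3 / 24\<close>.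
\<close>

text \<open>Since \<open>g'\<close> is nondecreasing and vanishes at \<open>m\<close>, it is
  nonpositive to the left of \<open>m\<close> and nonnegative to the right, so \<open>g\<close>
  attains its minimum at \<open>m\<close>.\<close>

lemma nonneg_if_second_derivative_nonneg:
  fixes g g' g'' :: "real \<Rightarrow> real"
  assumes g: "\<And>x. x \<in> {a..b} \<Longrightarrow> (g has_real_derivative g' x) (at x within {a..b})"
    and g': "\<And>x. x \<in> {a..b} \<Longrightarrow> (g' has_real_derivative g'' x) (at x within {a..b})"
    and g'': "\<And>x. x \<in> {a..b} \<Longrightarrow> 0 \<le> g'' x"
    and m: "m \<in> {a..b}" "g m = 0" "g' m = 0"
    and x: "x \<in> {a..b}"
  shows "0 \<le> g x"
proof -
  \<comment> \<open>Kept general in \<open>h\<close> because it serves twice: for \<open>g'\<close>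
    to obtain monotonicity, and for \<open>g\<close> to compare \<open>g x\<close> with
    \<open>g m\<close>.\<close>
  have mean_value: "\<exists>z\<in>{u..v}. h v - h u = h' z * (v - u)"
    if "\<And>x. x \<in> {a..b} \<Longrightarrow> (h has_real_derivative h' x) (at x within {a..b})"
      and "a \<le> u" "u \<le> v" "v \<le> b" for h h' :: "real \<Rightarrow> real" and u v
  proof (rule mvt_very_simple[OF \<open>u \<le> v\<close>, where f = h and f' = "\<lambda>z y. h' z * y"])
    fix z assume "u \<le> z" "z \<le> v"
    then have "(h has_real_derivative h' z) (at z within {u..v})"
      using that by (intro DERIV_subset[OF that(1)]) auto
    then show "(h has_derivative (*) (h' z)) (at z within {u..v})"
      by (simp add: has_field_derivative_def)
  qed
  have mono: "g' u \<le> g' v" if uv: "a \<le> u" "u \<le> v" "v \<le> b" for u v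
  proof -
    obtain z where "z \<in> {u..v}" "g' v - g' u = g'' z * (v - u)"
      using mean_value[OF g' uv] by blast
    moreover from this have "0 \<le> g'' z * (v - u)"
      using g''[of z] uv by (intro mult_nonneg_nonneg) auto
    ultimately show ?thesis
      by linarith
  qed
  show ?thesis
  proof (cases "m \<le> x")
    case True
    then obtain z where "z \<in> {m..x}" "g x - g m = g' z * (x - m)"
      using mean_value[OF g, of m x] m x by auto
    then show ?thesis
      using mono[of m z] m x by auto
  next
    case False
    then obtain z where "z \<in> {x..m}" "g m - g x = g' z * (m - x)"
      using mean_value[OF g, of x m] m x by auto
    then show ?thesis
      using mono[of z m] m x False mult_nonpos_nonneg[of "g' z" "m - x"] by auto
  qed
qed

text \<open>The remainder vanishes to first order at \<open>m\<close> and has second derivative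
  \<open>f''\<close>, so adding it to or subtracting it from \<open>M / 2 * (x - m)\<^sup>2\<close>
  leaves a function with nonnegative second derivative.\<close>

lemma taylor_remainder_bound:
  fixes f f' f'' :: "real \<Rightarrow> real"
  assumes f: "\<And>x. x \<in> {a..b} \<Longrightarrow> (f has_real_derivative f' x) (at x within {a..b})"
    and f': "\<And>x. x \<in> {a..b} \<Longrightarrow> (f' has_real_derivative f'' x) (at x within {a..b})"
    and bound: "\<And>x. x \<in> {a..b} \<Longrightarrow> \<bar>f'' x\<bar> \<le> M"
    and m: "m \<in> {a..b}"
    and x: "x \<in> {a..b}"
  shows "\<bar>f x - f m - f' m * (x - m)\<bar> \<le> M / 2 * (x - m)\<^sup>2"
proof -
  \<comment> \<open>The sign \<open>s\<close> treats both bounds at once: \<open>s = 1\<close>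
    bounds the remainder from below, \<open>s = -1\<close> from above.\<close>
  have "0 \<le> M / 2 * (x - m)\<^sup>2 + s * (f x - f m - f' m * (x - m))"
    if s: "s = 1 \<or> s = -1" for s :: real
  proof (rule nonneg_if_second_derivative_nonneg[OF _ _ _ m _ _ x,
        where g = "\<lambda>x. M / 2 * (x - m)\<^sup>2 + s * (f x - f m - f' m * (x - m))"
          and g' = "\<lambda>x. M * (x - m) + s * (f' x - f' m)"
          and g'' = "\<lambda>x. M + s * f'' x"])
    fix y assume y: "y \<in> {a..b}"
    show "((\<lambda>x. M / 2 * (x - m)\<^sup>2 + s * (f x - f m - f' m * (x - m)))
        has_real_derivative M * (y - m) + s * (f' y - f' m)) (at y within {a..b})"
      by (auto intro!: derivative_eq_intros f[OF y])
    show "((\<lambda>x. M * (x - m) + s * (f' x - f' m)) has_real_derivative M + s * f'' y)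
        (at y within {a..b})"
      by (auto intro!: derivative_eq_intros f'[OF y])
    show "0 \<le> M + s * f'' y"
      using bound[OF y] s by auto
  qed auto
  note signed = this[OF disjI1[OF refl]] this[OF disjI2[OF refl]]
  have "\<bar>r\<bar> \<le> B" if "0 \<le> B + 1 * r" "0 \<le> B + -1 * r" for r B :: real
    using that by simp
  from this[OF signed] show ?thesis .
qed

text \<open>The analytic core, for an arbitrary uniform bound \<open>M\<close>; quasi-convexity
  enters only through the choice of \<open>M\<close>.\<close>

lemma midpoint_rule_error:
  fixes f f' f'' :: "real \<Rightarrow> real"
  assumes "a < b"
    and f: "\<And>x. x \<in> {a..b} \<Longrightarrow> (f has_real_derivative f' x) (at x within {a..b})"
    and f': "\<And>x. x \<in> {a..b} \<Longrightarrow> (f' has_real_derivative f'' x) (at x within {a..b})"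
    and bound: "\<And>x. x \<in> {a..b} \<Longrightarrow> \<bar>f'' x\<bar> \<le> M"
  shows "\<bar>1 / (b - a) * integral {a..b} f - f ((a + b) / 2)\<bar> \<le> (b - a)\<^sup>2 / 24 * M"
proof -
  define m where "m = (a + b) / 2"
  have m: "m \<in> {a..b}" and dist: "b - m = (b - a) / 2" "a - m = - ((b - a) / 2)"
    using \<open>a < b\<close> by (auto simp: m_def field_simps)
  have "continuous_on {a..b} f"
    using f by (meson DERIV_continuous_on)
  then have int_f: "(f has_integral integral {a..b} f) {a..b}"
    by (intro integrable_integral integrable_continuous_interval)
  \<comment> \<open>The antiderivative is centred at \<open>m\<close> in its quadratic term, which
    then takes equal values at \<open>a\<close> and \<open>b\<close> and cancels.\<close>
  have "((\<lambda>x. f m + f' m * (x - m)) has_integral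
      (f m * b + f' m / 2 * (b - m)\<^sup>2) - (f m * a + f' m / 2 * (a - m)\<^sup>2)) {a..b}"
    using \<open>a < b\<close>
    by (intro fundamental_theorem_of_calculus)
      (auto intro!: derivative_eq_intros
        simp flip: has_real_derivative_iff_has_vector_derivative)
  also have "(f m * b + f' m / 2 * (b - m)\<^sup>2) - (f m * a + f' m / 2 * (a - m)\<^sup>2) = (b - a) * f m"
    unfolding dist by (simp add: algebra_simps)
  finally have int_remainder: "((\<lambda>x. f x - (f m + f' m * (x - m))) has_integral
      integral {a..b} f - (b - a) * f m) {a..b}"
    by (rule has_integral_diff[OF int_f])
  \<comment> \<open>The cube is odd about \<open>m\<close>, so each end contributes
    \<open>M / 48 * (b - a) ^ 3\<close>; this is the source of the constant 24.\<close>
  have "((\<lambda>x. M / 2 * (x - m)\<^sup>2) has_integral M / 6 * (b - m) ^ 3 - M / 6 * (a - m) ^ 3) {a..b}"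
    using \<open>a < b\<close>
    by (intro fundamental_theorem_of_calculus)
      (auto intro!: derivative_eq_intros
        simp flip: has_real_derivative_iff_has_vector_derivative)
  also have "M / 6 * (b - m) ^ 3 - M / 6 * (a - m) ^ 3 = M / 24 * (b - a) ^ 3"
    unfolding dist by (simp add: power_divide)
  finally have int_square: "((\<lambda>x. M / 2 * (x - m)\<^sup>2) has_integral M / 24 * (b - a) ^ 3) {a..b}" .
  have "norm (integral {a..b} (\<lambda>x. f x - (f m + f' m * (x - m))))
      \<le> integral {a..b} (\<lambda>x. M / 2 * (x - m)\<^sup>2)"
    using taylor_remainder_bound[OF f f' bound m] int_remainder int_square
    by (intro integral_norm_bound_integral) (auto simp: diff_diff_eq)
  then have "\<bar>integral {a..b} f - (b - a) * f m\<bar> \<le> M / 24 * (b - a) ^ 3"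
    unfolding integral_unique[OF int_remainder] integral_unique[OF int_square] by simp
  then have "\<bar>integral {a..b} f - (b - a) * f m\<bar> / (b - a) \<le> M / 24 * (b - a) ^ 3 / (b - a)"
    using \<open>a < b\<close> by (intro divide_right_mono) auto
  also have "M / 24 * (b - a) ^ 3 / (b - a) = (b - a)\<^sup>2 / 24 * M"
    using \<open>a < b\<close> by (simp add: power3_eq_cube power2_eq_square nonzero_divide_eq_eq)
  also have "\<bar>integral {a..b} f - (b - a) * f m\<bar> / (b - a)
      = \<bar>(integral {a..b} f - (b - a) * f m) / (b - a)\<bar>"
    using \<open>a < b\<close> by simp
  also have "(integral {a..b} f - (b - a) * f m) / (b - a) = 1 / (b - a) * integral {a..b} f - f m"
    using \<open>a < b\<close> by (simp add: diff_divide_distrib)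
  finally show ?thesis
    by (simp add: m_def)
qed

lemma quasi_convex_on_le_endpoints:
  assumes "quasi_convex_on {a..b} g" and x: "x \<in> {a..b}"
  shows "g x \<le> Sup {g a, g b}"
proof -
  \<comment> \<open>Orienting the segment from \<open>b\<close> to \<open>a\<close> puts the weight
    \<open>t\<close> on \<open>a\<close>, as in the definition of quasi-convexity.\<close>
  have "x \<in> closed_segment b a"
    using x by (simp add: closed_segment_eq_real_ivl)
  then obtain t where t: "t \<in> {0..1}" "x = t * a + (1 - t) * b"
    by (auto simp: in_segment)
  have "a \<in> {a..b}" "b \<in> {a..b}"
    using x by auto
  from assms(1)[unfolded quasi_convex_on_def, rule_format, OF this t(1)] show ?thesis
    unfolding t(2) .
qed

theorem theorem6:
  fixes I :: "real set" and a b :: real and f f' f'' :: "real \<Rightarrow> real"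
  assumes "is_interval I"
    and "a \<in> I" and "b \<in> I" and "a < b"
    and "\<And>x. x \<in> interior I \<union> {a..b} \<Longrightarrow> (f has_real_derivative f' x) (at x within I)"
    and "\<And>x. x \<in> interior I \<union> {a..b} \<Longrightarrow> (f' has_real_derivative f'' x) (at x within I)"
    and "f'' absolutely_integrable_on {a..b}"
    and "quasi_convex_on {a..b} (\<lambda>x. \<bar>f'' x\<bar>)"
  shows "\<bar>1 / (b - a) * integral {a..b} f - f ((a + b) / 2)\<bar>
    \<le> (b - a)\<^sup>2 / 24 * Sup {\<bar>f'' a\<bar>, \<bar>f'' b\<bar>}"
proof (rule midpoint_rule_error[OF \<open>a < b\<close>])
  \<comment> \<open>This inclusion lets derivatives within \<open>I\<close> be restricted to
    \<open>{a..b}\<close>, where they are one-sided at \<open>a\<close> and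
    \<open>b\<close>.\<close>
  have sub: "{a..b} \<subseteq> I"
    by (auto intro: mem_is_interval_1_I[OF assms(1-3)])
  fix x assume x: "x \<in> {a..b}"
  show "(f has_real_derivative f' x) (at x within {a..b})"
    using x sub by (intro DERIV_subset[OF assms(5)]) auto
  show "(f' has_real_derivative f'' x) (at x within {a..b})"
    using x sub by (intro DERIV_subset[OF assms(6)]) auto
  show "\<bar>f'' x\<bar> \<le> Sup {\<bar>f'' a\<bar>, \<bar>f'' b\<bar>}"
    by (rule quasi_convex_on_le_endpoints[OF assms(8) x])
qed

end
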